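(* Fix $\gamma\in\mathbb{C}$ and the bi-lattice $x(s)=s+\gamma(1+(-1)^s)$. Up to an affine transformation of the variable, the only classical orthogonal polynomials on this bi-lattice are $\big(Q_n^{\gamma}(\cdot;a,b,c)\big)_{n\ge0}$ and $\big(H_n^{\gamma}(\cdot;a,b)\big)_{n\ge0}$. That is: each such sequence $Q^{\gamma}$ and $H^{\gamma}$ (with admissible parameters) is a sequence of classical orthogonal polynomials on the bi-lattice, and conversely, if $(P_n)_{n\ge0}$ is a monic sequence of classical orthogonal polynomials on the bi-lattice, then there are $\alpha\in\mathbb{C}\setminus\{0\}$, $\beta\in\mathbb{C}$ such that either $P_n(z)=\alpha^{-n}Q_n^{\gamma}(\alpha z+\beta;a,b,c)$ for all $n\geq 0$, for some admissible $a,b,c\in\mathbb{C}$, or $P_n(z)=\alpha^{-n}H_n^{\gamma}(\alpha z+\beta;a,b)$ for all $n\ge0$, for some admissible $a,b\in\mathbb{C}$.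
   Context: $\mathcal{P}$ is the space of complex polynomials in $z$, $\mathcal{P}_n$ the polynomials of degree $\le n$, $\mathcal{P}^*$ the algebraic dual of $\mathcal{P}$. A sequence of orthogonal polynomials with respect to $\mathbf{u}\in\mathcal{P}^*$ is a sequence $(P_n)_{n\ge0}$ with $\deg P_n=n$ and $\langle\mathbf{u},P_nP_k\rangle=h_n\delta_{n,k}$, $h_n\neq0$; $\mathbf{u}$ is regular if such a sequence exists. Operators on the bi-lattice. For $x(s)=s+\gamma(1+(-1)^s)$ set $$\mathrm{D}_sf(x(s))=\tfrac12\big(f(x(s+1))-f(x(s-1))\big),\qquad \mathrm{S}_sf(x(s))=\tfrac12\big(f(x(s+1))+f(x(s-1))\big).$$ Convention: write $z=x(s)$ and $\varepsilon=(-1)^s$, treated as a sign with $\varepsilon^2=1$. Since $x(s\pm1)=x(s)-2\gamma(-1)^s\pm1$ and $(-1)^{s\pm1}=-(-1)^s$, the operators act on the algebra $\widehat{\mathcal{P}}=E[z]$ of polynomials in $z$ whose coefficients lie in the algebra $E$ of complex functions of $\varepsilon\in\{1,-1\}$, by $$\mathrm{D}_sf(z,\varepsilon)=\tfrac12\big(f(z-2\gamma\varepsilon+1,-\varepsilon)-f(z-2\gamma\varepsilon-1,-\varepsilon)\big),$$ $$\mathrm{S}_sf(z,\varepsilon)=\tfrac12\big(f(z-2\gamma\varepsilon+1,-\varepsilon)+f(z-2\gamma\varepsilon-1,-\varepsilon)\big).$$ Functionals are $\mathbb{C}$-linear maps $\widehat{\mathcal{P}}\to E$; $\mathbf{u}\in\mathcal{P}^*$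 is viewed as such a map by extending it $E$-linearly. For a functional $\mathbf{v}$ and $f,g\in\widehat{\mathcal{P}}$: $\langle f\mathbf{v},g\rangle=\langle\mathbf{v},fg\rangle$, $\langle\mathbf{D}_s\mathbf{v},f\rangle=-\langle\mathbf{v},\mathrm{D}_sf\rangle$, $\langle\mathbf{S}_s\mathbf{v},f\rangle=\langle\mathbf{v},\mathrm{S}_sf\rangle$. $\mathbf{u}\in\mathcal{P}^*$ is bi-classical if it is regular and there exist nonzero $\phi\in\mathcal{P}_2$ and nonzero $\psi\in\mathcal{P}_1$ with $\mathbf{D}_s(\phi\mathbf{u})=\mathbf{S}_s(\psi\mathbf{u})$. A sequence of orthogonal polynomials with respect to a bi-classical $\mathbf{u}$ is called a sequence of classical orthogonal polynomials on the bi-lattice. The two families are the monic sequences given by $P_{n+1}(z)=(z-B_n)P_n(z)-C_nP_{n-1}(z)$, $P_{-1}=0$, $P_0=1$, with the following coefficients. (H) For $H_n^{\gamma}(\cdot;a,b)$: $B_n=-2n\sqrt{a+1}$, $C_{n+1}=(an+b)(n+1)$ for $n\ge0$, where $\sqrt{a+1}$ is a fixed choice of square root; admissible parameters: $a,b\in\mathbb{C}$ with $an+b\neq0$ for all $n=0,1,\ldots$. (Q) For $Q_n^{\gamma}(\cdot;a,b,c)$: for $n\ge0$, $$B_n=\frac{(a-1)bc}{(n+a)(n+a-1)},$$ $$C_{n+1}=-\frac{(n+1)(n+a+b)(n+a-b)(n+a+c)(n+a-c)(n+2a-1)}{(2n+2a-1)(n+a)^2(2n+2a+1)},$$ where for $n=0$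 common factors are cancelled, i.e. $B_0=bc/a$ and $C_1=-\frac{(a^2-b^2)(a^2-c^2)}{a^2(2a+1)}$; admissible parameters: $a,b,c\in\mathbb{C}$ such that none of $-2a,\,-a-b,\,-a+b,\,-a-c,\,-a+c$ belongs to $\mathbb{N}_0=\{0,1,2,\ldots\}$. *)

theory Defs
  imports
    Complex_Main
    "HOL-Library.Function_Algebras"
    "HOL-Computational_Algebra.Polynomial"
begin

(* The two values of \<epsilon> = (-1)^s. *)
datatype sign = Plus | Minus

fun flip :: "sign \<Rightarrow> sign" where
  "flip Plus = Minus"
| "flip Minus = Plus"

(* The algebra E of complex functions of \<epsilon>, with the pointwise ring structure of
   Function_Algebras; the type "E poly" is then E[z]. *)
type_synonym E = "sign \<Rightarrow> complex"

definition const :: "complex \<Rightarrow> E" where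
  "const c = (\<lambda>_. c)"

definition eps :: E where
  "eps = (\<lambda>s. case s of Plus \<Rightarrow> 1 | Minus \<Rightarrow> - 1)"

abbreviation embed :: "complex poly \<Rightarrow> E poly" where
  "embed \<equiv> map_poly const"

(* f(z, \<epsilon>) \<mapsto> f(z + c(\<epsilon>), -\<epsilon>) *)
definition shift :: "E \<Rightarrow> E poly \<Rightarrow> E poly" where
  "shift c f = pcompose (map_poly (\<lambda>e. e \<circ> flip) f) [:c, 1:]"

definition Ds :: "complex \<Rightarrow> E poly \<Rightarrow> E poly" where
  "Ds \<gamma> f = smult (const (1/2))
     (shift (- const (2 * \<gamma>) * eps + 1) f - shift (- const (2 * \<gamma>) * eps - 1) f)"

definition Ss :: "complex \<Rightarrow> E poly \<Rightarrow> E poly" where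
  "Ss \<gamma> f = smult (const (1/2))
     (shift (- const (2 * \<gamma>) * eps + 1) f + shift (- const (2 * \<gamma>) * eps - 1) f)"

definition dual :: "(complex poly \<Rightarrow> complex) set" where
  "dual = {u. Vector_Spaces.linear smult (*) u}"

(* The E-linear extension: u(\<Sum>k. e_k z^k) = \<Sum>k. e_k u(z^k). *)
definition extend :: "(complex poly \<Rightarrow> complex) \<Rightarrow> (E poly \<Rightarrow> E)" where
  "extend u f = (\<Sum>k\<le>degree f. coeff f k * const (u (monom 1 k)))"

definition lmult :: "E poly \<Rightarrow> (E poly \<Rightarrow> E) \<Rightarrow> (E poly \<Rightarrow> E)" where
  "lmult f v = (\<lambda>g. v (f * g))"

definition Ds_dual :: "complex \<Rightarrow> (E poly \<Rightarrow> E) \<Rightarrow> (E poly \<Rightarrow> E)" where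
  "Ds_dual \<gamma> v = (\<lambda>f. - v (Ds \<gamma> f))"

definition Ss_dual :: "complex \<Rightarrow> (E poly \<Rightarrow> E) \<Rightarrow> (E poly \<Rightarrow> E)" where
  "Ss_dual \<gamma> v = (\<lambda>f. v (Ss \<gamma> f))"

definition is_OPS :: "(complex poly \<Rightarrow> complex) \<Rightarrow> (nat \<Rightarrow> complex poly) \<Rightarrow> bool" where
  "is_OPS u P \<longleftrightarrow> (\<forall>n. degree (P n) = n) \<and>
     (\<exists>h. (\<forall>n. h n \<noteq> 0) \<and> (\<forall>n k. u (P n * P k) = (if n = k then h n else 0)))"

definition regular :: "(complex poly \<Rightarrow> complex) \<Rightarrow> bool" where
  "regular u \<longleftrightarrow> (\<exists>P. is_OPS u P)"

definition bi_classical :: "complex \<Rightarrow> (complex poly \<Rightarrow> complex) \<Rightarrow> bool" where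
  "bi_classical \<gamma> u \<longleftrightarrow> u \<in> dual \<and> regular u \<and>
     (\<exists>\<phi> \<psi>. \<phi> \<noteq> 0 \<and> degree \<phi> \<le> 2 \<and> \<psi> \<noteq> 0 \<and> degree \<psi> \<le> 1 \<and>
        Ds_dual \<gamma> (lmult (embed \<phi>) (extend u)) = Ss_dual \<gamma> (lmult (embed \<psi>) (extend u)))"

definition classical_OPS :: "complex \<Rightarrow> (nat \<Rightarrow> complex poly) \<Rightarrow> bool" where
  "classical_OPS \<gamma> P \<longleftrightarrow> (\<exists>u. bi_classical \<gamma> u \<and> is_OPS u P)"

(* The second argument is indexed with an offset: C n stands for C_{n+1}.
   C_0 is irrelevant since P_{-1} = 0. *)
fun monic_rec :: "(nat \<Rightarrow> complex) \<Rightarrow> (nat \<Rightarrow> complex) \<Rightarrow> nat \<Rightarrow> complex poly" where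
  "monic_rec B C 0 = 1"
| "monic_rec B C (Suc 0) = [:- B 0, 1:]"
| "monic_rec B C (Suc (Suc n)) =
     [:- B (Suc n), 1:] * monic_rec B C (Suc n) - smult (C n) (monic_rec B C n)"

(* The recurrence coefficients of both families do not involve \<gamma>.
   The parameter sq is the choice of the square root. *)
definition H_B :: "(complex \<Rightarrow> complex) \<Rightarrow> complex \<Rightarrow> nat \<Rightarrow> complex" where
  "H_B sq a n = - 2 * of_nat n * sq (a + 1)"

definition H_C :: "complex \<Rightarrow> complex \<Rightarrow> nat \<Rightarrow> complex" where
  "H_C a b n = (a * of_nat n + b) * (of_nat n + 1)"

definition H_poly :: "(complex \<Rightarrow> complex) \<Rightarrow> complex \<Rightarrow> complex \<Rightarrow> nat \<Rightarrow> complex poly" where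
  "H_poly sq a b = monic_rec (H_B sq a) (H_C a b)"

definition H_admissible :: "complex \<Rightarrow> complex \<Rightarrow> bool" where
  "H_admissible a b \<longleftrightarrow> (\<forall>n::nat. a * of_nat n + b \<noteq> 0)"

(* At n = 0 the general formulas read 0/0 for the admissible values a = 1 and a = 1/2
   respectively, so the common factors are cancelled there. *)
definition Q_B :: "complex \<Rightarrow> complex \<Rightarrow> complex \<Rightarrow> nat \<Rightarrow> complex" where
  "Q_B a b c n =
     (if n = 0 then b * c / a
      else (a - 1) * b * c / ((of_nat n + a) * (of_nat n + a - 1)))"

definition Q_C :: "complex \<Rightarrow> complex \<Rightarrow> complex \<Rightarrow> nat \<Rightarrow> complex" where
  "Q_C a b c n =
     (if n = 0 then - ((a^2 - b^2) * (a^2 - c^2) / (a^2 * (2 * a + 1)))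
      else - ((of_nat n + 1) * (of_nat n + a + b) * (of_nat n + a - b) *
                (of_nat n + a + c) * (of_nat n + a - c) * (of_nat n + 2 * a - 1) /
              ((2 * of_nat n + 2 * a - 1) * (of_nat n + a)^2 * (2 * of_nat n + 2 * a + 1))))"

definition Q_poly :: "complex \<Rightarrow> complex \<Rightarrow> complex \<Rightarrow> nat \<Rightarrow> complex poly" where
  "Q_poly a b c = monic_rec (Q_B a b c) (Q_C a b c)"

definition Q_admissible :: "complex \<Rightarrow> complex \<Rightarrow> complex \<Rightarrow> bool" where
  "Q_admissible a b c \<longleftrightarrow>
     - 2 * a \<notin> \<nat> \<and> - a - b \<notin> \<nat> \<and> - a + b \<notin> \<nat> \<and> - a - c \<notin> \<nat> \<and> - a + c \<notin> \<nat>"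

(* The polynomial \<alpha>^{-n} p(\<alpha> z + \<beta>) in z. *)
definition affine :: "complex \<Rightarrow> complex \<Rightarrow> nat \<Rightarrow> complex poly \<Rightarrow> complex poly" where
  "affine \<alpha> \<beta> n p = smult (inverse (\<alpha> ^ n)) (pcompose p [:\<beta>, \<alpha>:])"

end

theory Submission
  imports Defs
begin

text \<open>
  Testing the functional equation on both signs and translating the test polynomial shows that it is
  equivalent to \<open>u (\<phi> Dp + \<psi> Sp) = 0\<close> for all complex polynomials \<open>p\<close>, where \<open>D\<close> and \<open>S\<close> are the
  central difference and mean with step one; \<open>\<gamma>\<close> disappears. Write \<open>T p = \<phi> Dp + \<psi> Sp\<close>.

  For each family the operator \<open>T\<close> maps a companion family of the same kind to multiples of the
  members of positive index of the given one, so the Favard functional satisfies the equation.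
  Conversely, regularity forces \<open>T\<close> to raise degrees by exactly one, so the equation determines the
  functional up to a scalar, and it remains to normalise \<open>(\<phi>, \<psi>)\<close> by a translation or a reflection:
  to \<open>(z\<^sup>2 + a\<^sup>2 - b\<^sup>2 - c\<^sup>2, 2 (a z - b c))\<close> if \<open>\<phi>\<close> is quadratic, and otherwise to
  \<open>(sqrt (a + 1) z - b, z)\<close>.
\<close>

section \<open>Evaluation of \<open>E\<close>-valued polynomials at a sign; linear
  functionals\<close>

definition proj :: "sign \<Rightarrow> E poly \<Rightarrow> complex poly" where
  "proj s = map_poly (\<lambda>e. e s)"

lemma sum_fun_at: "(\<Sum>i\<in>A. (f i :: E)) s = (\<Sum>i\<in>A. f i s)"
  by (induction A rule: infinite_finite_induct) auto

lemma coeff_proj [simp]: "coeff (proj s f) n = coeff f n s"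
  by (simp add: proj_def coeff_map_poly)

lemma proj_simps [simp]:
  "proj s 0 = 0"
  "proj s (f + g) = proj s f + proj s g"
  "proj s (f - g) = proj s f - proj s g"
  "proj s (f * g) = proj s f * proj s g"
  "proj s (smult e f) = smult (e s) (proj s f)"
  "proj s (pCons e f) = pCons (e s) (proj s f)"
  by (auto intro!: poly_eqI simp: coeff_mult sum_fun_at coeff_pCons split: nat.splits)

lemma proj_embed [simp]: "proj s (embed p) = p"
  by (rule poly_eqI) (simp add: coeff_map_poly const_def zero_fun_def)

lemma proj_pcompose: "proj s (pcompose f g) = pcompose (proj s f) (proj s g)"
  by (induction f) (auto simp: pcompose_pCons)

lemma proj_shift: "proj s (shift c f) = pcompose (proj (flip s) f) [:c s, 1:]"
proof -
  have "proj s (map_poly (\<lambda>e. e \<circ> flip) f) = proj (flip s) f"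
    by (rule poly_eqI) (simp add: coeff_map_poly zero_fun_def comp_def)
  then show ?thesis
    by (simp add: shift_def proj_pcompose one_fun_def)
qed

lemma dual_simps:
  assumes "u \<in> dual"
  shows "u (p + q) = u p + u q" "u (p - q) = u p - u q" "u (smult c p) = c * u p"
    "u 0 = 0" "u (- p) = - u p" "u (sum f A) = (\<Sum>x\<in>A. u (f x))"
proof -
  interpret Vector_Spaces.linear smult "(*)" u
    using assms by (simp add: dual_def)
  show "u (p + q) = u p + u q" "u (p - q) = u p - u q" "u (smult c p) = c * u p"
    "u 0 = 0" "u (- p) = - u p" "u (sum f A) = (\<Sum>x\<in>A. u (f x))"
    by (simp_all add: add diff scale zero neg sum)
qed

lemma dualI:
  assumes "\<And>p q. u (p + q) = u p + u q" "\<And>c p. u (smult c p) = c * u p"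
  shows "u \<in> dual"
  unfolding dual_def mem_Collect_eq
  by unfold_locales (simp_all add: assms algebra_simps smult_add_right smult_add_left)

section \<open>Central difference and mean; the functional equation freed of \<gamma>\<close>

definition cdiff :: "complex poly \<Rightarrow> complex poly" where
  "cdiff p = smult (1/2) (pcompose p [:1, 1:] - pcompose p [:- 1, 1:])"

definition cmean :: "complex poly \<Rightarrow> complex poly" where
  "cmean p = smult (1/2) (pcompose p [:1, 1:] + pcompose p [:- 1, 1:])"

definition pearson_op :: "complex poly \<Rightarrow> complex poly \<Rightarrow> complex poly \<Rightarrow> complex poly" where
  "pearson_op \<phi> \<psi> p = \<phi> * cdiff p + \<psi> * cmean p"

definition pearson :: "complex poly \<Rightarrow> complex poly \<Rightarrow> (complex poly \<Rightarrow> complex) \<Rightarrow> bool" where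
  "pearson \<phi> \<psi> u \<longleftrightarrow> (\<forall>p. u (pearson_op \<phi> \<psi> p) = 0)"

lemma extend_at:
  assumes "u \<in> dual"
  shows "extend u f s = u (proj s f)"
proof -
  \<comment> \<open>The leading coefficient of \<open>f\<close> may vanish at \<open>s\<close>, so
    the monomial sum runs up to \<open>degree f\<close>, not up to the degree of the
    projection.\<close>
  have "degree (proj s f) \<le> degree f"
    by (rule degree_le) (simp add: coeff_eq_0)
  then have "u (proj s f) = u (\<Sum>k\<le>degree f. monom (coeff f k s) k)"
    using poly_as_sum_of_monoms'[of "proj s f" "degree f"] by simp
  also have "\<dots> = (\<Sum>k\<le>degree f. u (smult (coeff f k s) (monom 1 k)))"
    by (simp add: dual_simps(6)[OF assms] smult_monom)
  also have "\<dots> = extend u f s"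
    by (simp add: extend_def sum_fun_at const_def dual_simps[OF assms])
  finally show ?thesis by simp
qed

lemma proj_Ds:
  "proj s (Ds \<gamma> f) = cdiff (pcompose (proj (flip s) f) [:- 2 * \<gamma> * eps s, 1:])"
  by (simp add: Ds_def cdiff_def proj_shift const_def pcompose_assoc[symmetric] pcompose_pCons one_fun_def)

lemma proj_Ss:
  "proj s (Ss \<gamma> f) = cmean (pcompose (proj (flip s) f) [:- 2 * \<gamma> * eps s, 1:])"
  by (simp add: Ss_def cmean_def proj_shift const_def pcompose_assoc[symmetric] pcompose_pCons one_fun_def)

text \<open>The lattice parameter only enters through an invertible translation of the test
  polynomial, so the functional equation does not depend on it.\<close>

lemma functional_equation_iff_pearson:
  assumes "u \<in> dual"
  shows "Ds_dual \<gamma> (lmult (embed \<phi>) (extend u)) = Ss_dual \<gamma> (lmult (embed \<psi>) (extend u))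
    \<longleftrightarrow> pearson \<phi> \<psi> u" (is "?L \<longleftrightarrow> ?R")
proof -
  let ?q = "\<lambda>f s. pcompose (proj (flip s) f) [:- 2 * \<gamma> * eps s, 1:]"
  have 1: "?L \<longleftrightarrow> (\<forall>f s. u (pearson_op \<phi> \<psi> (?q f s)) = 0)"
  proof -
    have "?L \<longleftrightarrow> (\<forall>f s. - u (\<phi> * cdiff (?q f s)) = u (\<psi> * cmean (?q f s)))"
      by (simp only: fun_eq_iff Ds_dual_def Ss_dual_def lmult_def fun_Compl_def extend_at[OF assms]
          proj_simps proj_embed proj_Ds proj_Ss)
    then show ?thesis
      by (simp add: pearson_op_def dual_simps[OF assms] neg_eq_iff_add_eq_0)
  qed
  have "\<exists>f s. p = ?q f s" for p
  proof (intro exI)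
    \<comment> \<open>The translation undoes the one inside \<open>?q\<close>; a single sign already
      reaches every test polynomial.\<close>
    show "p = ?q (embed (pcompose p [:2 * \<gamma> * eps Plus, 1:])) Plus"
      by (simp add: pcompose_assoc[symmetric] pcompose_pCons)
  qed
  with 1 show ?thesis
    unfolding pearson_def by metis
qed

section \<open>Degrees and leading coefficients under the difference operators\<close>

lemma pcompose_linear_pCons:
  "pcompose (pCons 0 p) [:c, 1:] = smult c (pcompose p [:c, 1:]) + pCons 0 (pcompose p [:c, 1:])"
  for c :: complex
  by (simp add: pcompose_pCons)

lemma cdiff_pCons0: "cdiff (pCons 0 p) = pCons 0 (cdiff p) + cmean p"
  by (rule poly_eqI) (simp add: cdiff_def cmean_def pcompose_linear_pCons coeff_pCons field_simps split: nat.split)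

lemma cmean_pCons0: "cmean (pCons 0 p) = pCons 0 (cmean p) + cdiff p"
  by (rule poly_eqI) (simp add: cdiff_def cmean_def pcompose_linear_pCons coeff_pCons field_simps split: nat.split)

text \<open>Multiplication by z follows from D(zp) = z Dp + Sp and S(zp) = z Sp + Dp. The remainder
  is the operator with \<phi> and \<psi> exchanged, so later inductions treat both operators at
  once.\<close>

lemma pearson_op_pCons0:
  "pearson_op \<phi> \<psi> (pCons 0 p) = pCons 0 (pearson_op \<phi> \<psi> p) + pearson_op \<psi> \<phi> p"
  by (simp add: pearson_op_def cdiff_pCons0 cmean_pCons0 algebra_simps)

lemma pearson_op_simps:
  "pearson_op \<phi> \<psi> 0 = 0"
  "pearson_op \<phi> \<psi> (p + q) = pearson_op \<phi> \<psi> p + pearson_op \<phi> \<psi> q"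
  "pearson_op \<phi> \<psi> (p - q) = pearson_op \<phi> \<psi> p - pearson_op \<phi> \<psi> q"
  "pearson_op \<phi> \<psi> (smult c p) = smult c (pearson_op \<phi> \<psi> p)"
  by (simp_all add: pearson_op_def cdiff_def cmean_def pcompose_add pcompose_diff pcompose_smult
      algebra_simps smult_add_right smult_diff_right)

lemma pearson_op_1: "pearson_op \<phi> \<psi> 1 = \<psi>"
  by (simp add: pearson_op_def cdiff_def cmean_def pcompose_1 numeral_poly)

lemma coeff_pearson_op_monom:
  assumes "degree \<phi> \<le> 2" "degree \<psi> \<le> 1"
  shows "degree (pearson_op \<phi> \<psi> (monom 1 k)) \<le> Suc k"
    and "coeff (pearson_op \<phi> \<psi> (monom 1 k)) (Suc k) = of_nat k * coeff \<phi> 2 + coeff \<psi> 1"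
proof -
  \<comment> \<open>The exchanged operator raises degrees by at most two with constant top
    coefficient \<open>coeff \<phi> 2\<close>; each multiplication by z adds this to the top
    coefficient of the original operator.\<close>
  have "(\<forall>i>Suc k. coeff (pearson_op \<phi> \<psi> (monom 1 k)) i = 0) \<and>
    (\<forall>i>Suc (Suc k). coeff (pearson_op \<psi> \<phi> (monom 1 k)) i = 0) \<and>
    coeff (pearson_op \<phi> \<psi> (monom 1 k)) (Suc k) = of_nat k * coeff \<phi> 2 + coeff \<psi> 1 \<and>
    coeff (pearson_op \<psi> \<phi> (monom 1 k)) (Suc (Suc k)) = coeff \<phi> 2"
  proof (induction k)
    case 0
    then show ?case
      using assms by (simp add: monom_0 pearson_op_1 coeff_eq_0 numeral_2_eq_2 flip: one_pCons)
  next
    case (Suc k)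
    then show ?case
      by (auto simp: monom_Suc pearson_op_pCons0 coeff_pCons algebra_simps split: nat.split)
  qed
  then show "degree (pearson_op \<phi> \<psi> (monom 1 k)) \<le> Suc k"
    and "coeff (pearson_op \<phi> \<psi> (monom 1 k)) (Suc k) = of_nat k * coeff \<phi> 2 + coeff \<psi> 1"
    by (auto intro: degree_le)
qed

lemma cdiff_monom:
  "degree (cdiff (monom 1 (Suc k))) \<le> k"
  "coeff (cdiff (monom 1 (Suc k))) k = of_nat (Suc k)"
proof -
  \<comment> \<open>With \<phi> the square of z and \<psi> = 0 the operator is D followed by two
    multiplications by z, so the coefficient formula can be read off for D itself.\<close>
  have eq: "pearson_op [:0, 0, 1:] 0 p = pCons 0 (pCons 0 (cdiff p))" for p
    by (simp add: pearson_op_def)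
  have "degree [:0, 0, 1 :: complex:] \<le> 2" by simp
  note * = coeff_pearson_op_monom[OF this, of 0 "Suc k", unfolded eq]
  show "coeff (cdiff (monom 1 (Suc k))) k = of_nat (Suc k)"
    using *(2) by (simp add: numeral_2_eq_2)
  show "degree (cdiff (monom 1 (Suc k))) \<le> k"
    using *(1) by (cases "cdiff (monom 1 (Suc k)) = 0") (auto simp: degree_pCons_eq)
qed

text \<open>Subtracting a multiple of \<open>F m\<close> removes the coefficient at
  \<open>m\<close>. Hence a family with one member of each exact degree up to \<open>n\<close> spans
  the polynomials of degree at most \<open>n\<close>, and a linear property need only be checked on
  it.\<close>

lemma exact_degree_induct:
  fixes F :: "nat \<Rightarrow> complex poly"
  assumes "degree q \<le> n"
    and F: "\<And>k. k \<le> n \<Longrightarrow> degree (F k) \<le> k" "\<And>k. k \<le> n \<Longrightarrow> coeff (F k) k \<noteq> 0"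
    and V: "V 0" "\<And>p q. V p \<Longrightarrow> V q \<Longrightarrow> V (p + q)" "\<And>c p. V p \<Longrightarrow> V (smult c p)"
      "\<And>k. k \<le> n \<Longrightarrow> V (F k)"
  shows "V q"
proof -
  \<comment> \<open>Here \<open>m\<close> is one more than the degree bound, so that
    \<open>m = 0\<close> leaves only the zero polynomial.\<close>
  have "V q" if "m \<le> Suc n" "\<And>i. i \<ge> m \<Longrightarrow> coeff q i = 0" for m q
    using that
  proof (induction m arbitrary: q)
    case 0
    then have "q = 0" by (simp add: poly_eq_iff)
    then show ?case using V by simp
  next
    case (Suc m)
    define c where "c = coeff q m / coeff (F m) m"
    have "coeff (q - smult c (F m)) i = 0" if "i \<ge> m" for i
      using that Suc.prems F[of m] coeff_eq_0[of "F m" i] by (cases "i = m") (auto simp: c_def)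
    then have "V (q - smult c (F m))" using Suc by auto
    then have "V ((q - smult c (F m)) + smult c (F m))" using V Suc.prems by blast
    then show ?case by simp
  qed
  from this[of "Suc n" q] assms(1) show ?thesis by (simp add: coeff_eq_0)
qed

section \<open>Monic three-term recurrences and Favard's functional\<close>

lemma monic_rec_mult_X:
  "pCons 0 (monic_rec B C 0) = monic_rec B C 1 + smult (B 0) (monic_rec B C 0)"
  "pCons 0 (monic_rec B C (Suc n)) =
    monic_rec B C (Suc (Suc n)) + smult (B (Suc n)) (monic_rec B C (Suc n)) + smult (C n) (monic_rec B C n)"
  by (simp_all add: one_pCons)

lemma monic_rec_degree_coeff: "degree (monic_rec B C n) \<le> n \<and> coeff (monic_rec B C n) n = 1"
proof (induction n rule: induct_nat_012)
  case (ge2 n)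
  then have *: "coeff (monic_rec B C n) i = 0" "coeff (monic_rec B C (Suc n)) (Suc i) = 0" "coeff (monic_rec B C (Suc n)) (Suc (Suc i)) = 0"
    if "i > n" for i
    using that by (simp_all add: coeff_eq_0)
  have "degree (monic_rec B C (Suc (Suc n))) \<le> Suc (Suc n)"
    by (rule degree_le) (use ge2 in \<open>auto simp: coeff_eq_0 coeff_pCons split: nat.split\<close>)
  then show ?case
    using ge2 * by (simp add: coeff_pCons)
qed (auto simp: one_pCons)

lemma coeff_monic_rec [simp]: "coeff (monic_rec B C n) n = 1"
  using monic_rec_degree_coeff by blast

lemma degree_monic_rec [simp]: "degree (monic_rec B C n) = n"
  using monic_rec_degree_coeff[of B C n] le_degree[of "monic_rec B C n" n] by simp

lemma monic_rec_nonzero [simp]: "monic_rec B C n \<noteq> 0"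
  using coeff_monic_rec[of B C n] by (metis coeff_0 zero_neq_one)

text \<open>For monic \<open>Q n\<close> of degree \<open>n\<close>, this recursion solves for the
  moments of the functional that is 1 at the constant 1 and 0 at every \<open>Q n\<close> with
  \<open>n > 0\<close>.\<close>

fun moment :: "(nat \<Rightarrow> complex poly) \<Rightarrow> nat \<Rightarrow> complex" where
  "moment Q n = (if n = 0 then 1 else - (\<Sum>k<n. coeff (Q n) k * moment Q k))"

declare moment.simps [simp del]

text \<open>The functional dual to the first element of the basis \<open>Q\<close>; for a sequence given by a
  three-term recurrence this is the orthogonality functional of Favard's theorem.\<close>

definition favard :: "(nat \<Rightarrow> complex poly) \<Rightarrow> complex poly \<Rightarrow> complex" where
  "favard Q p = (\<Sum>k\<le>degree p. coeff p k * moment Q k)"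

lemma favard_eq:
  assumes "degree p \<le> n"
  shows "favard Q p = (\<Sum>k\<le>n. coeff p k * moment Q k)"
  unfolding favard_def by (rule sum.mono_neutral_left) (use assms in \<open>auto simp: coeff_eq_0\<close>)

lemma favard_dual: "favard Q \<in> dual"
proof (rule dualI)
  fix p q :: "complex poly" and c
  let ?n = "max (degree p) (degree q)"
  have "degree (p + q) \<le> ?n" by (rule degree_add_le) auto
  then show "favard Q (p + q) = favard Q p + favard Q q"
    by (simp add: favard_eq[of _ ?n] algebra_simps sum.distrib)
  show "favard Q (smult c p) = c * favard Q p"
    by (simp add: favard_eq[of _ "degree p"] sum_distrib_left algebra_simps)
qed

lemma favard_monic_rec: "favard (monic_rec B C) (monic_rec B C n) = (if n = 0 then 1 else 0)"
proof (cases n)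
  case 0
  then show ?thesis by (simp add: favard_def moment.simps)
next
  case (Suc m)
  let ?Q = "monic_rec B C"
  have "favard ?Q (?Q n) = (\<Sum>k<n. coeff (?Q n) k * moment ?Q k) + moment ?Q n"
    by (simp add: favard_def lessThan_Suc_atMost[symmetric])
  also have "\<dots> = 0"
    using Suc by (subst (2) moment.simps) simp
  finally show ?thesis using Suc by simp
qed

text \<open>Multiplication by z is symmetric for the form u(pq). Expanding it in either factor by
  the recurrence expresses a row of the Gram matrix through the two rows before; row 0 is known by
  construction of the functional.\<close>

lemma favard_orthogonal:
  assumes "m \<le> n"
  shows "favard (monic_rec B C) (monic_rec B C m * monic_rec B C n) =
    (if m = n then \<Prod>i<n. C i else 0)"
proof -
  let ?Q = "monic_rec B C"
  define s where "s i j = favard ?Q (?Q i * ?Q j)" for i j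
  note lin = dual_simps[OF favard_dual]
  have left: "favard ?Q (pCons 0 (?Q i) * ?Q j) = s (Suc i) j + B i * s i j +
      (case i of 0 \<Rightarrow> 0 | Suc k \<Rightarrow> C k * s k j)" for i j
    using monic_rec_mult_X[of B C] by (cases i) (simp_all only: s_def distrib_right lin mult_smult_left nat.case One_nat_def add_0_right)
  have right: "favard ?Q (pCons 0 (?Q i) * ?Q j) = s i (Suc j) + B j * s i j +
      (case j of 0 \<Rightarrow> 0 | Suc k \<Rightarrow> C k * s i k)" for i j
  proof -
    have "pCons 0 (?Q i) * ?Q j = ?Q i * pCons 0 (?Q j)" by simp
    then show ?thesis
      using monic_rec_mult_X[of B C] by (cases j) (simp_all only: s_def distrib_left lin mult_smult_right nat.case One_nat_def add_0_right)
  qed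
  have step: "s (Suc i) j = s i (Suc j) + B j * s i j + (case j of 0 \<Rightarrow> 0 | Suc k \<Rightarrow> C k * s i k)
      - B i * s i j - (case i of 0 \<Rightarrow> 0 | Suc k \<Rightarrow> C k * s k j)" for i j
    using left[of i j] right[of i j] by (simp add: algebra_simps)
  have "\<forall>n\<ge>m. s m n = (if m = n then \<Prod>i<n. C i else 0)"
  proof (induction m rule: induct_nat_012)
    case 0
    then show ?case by (auto simp: s_def favard_monic_rec)
  next
    case 1
    have "s 0 j = (if j = 0 then 1 else 0)" for j by (simp add: s_def favard_monic_rec)
    then show ?case by (auto simp: step[of 0, simplified] split: nat.split)
  next
    case (ge2 m)
    then show ?case by (auto simp: step[of "Suc m"] split: nat.split)
  qed
  with assms show ?thesis by (simp add: s_def)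
qed

lemma is_OPS_favard:
  assumes "\<And>n. C n \<noteq> 0"
  shows "is_OPS (favard (monic_rec B C)) (monic_rec B C)"
  unfolding is_OPS_def
proof (intro conjI allI exI)
  fix n k
  show "(\<Prod>i<n. C i) \<noteq> 0" using assms by simp
  show "favard (monic_rec B C) (monic_rec B C n * monic_rec B C k) = (if n = k then \<Prod>i<n. C i else 0)"
    using favard_orthogonal[of n k B C] favard_orthogonal[of k n B C] by (cases n k rule: le_cases) (auto simp: mult.commute)
qed simp

section \<open>Raising relations as a criterion for the functional equation\<close>

lemma pCons_0_linear:
  "pCons 0 (smult c p) = smult c (pCons 0 p)" "pCons 0 (p + q) = pCons 0 p + pCons 0 q" for c :: complex
  by simp_all

text \<open>A one-term raising relation: the Pearson operator maps the companion sequence with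
  coefficients \<open>B', C'\<close> to multiples of \<open>Q 1, Q 2, \<dots>\<close>, all of which are annihilated by the
  functional. Both coefficient sequences \<open>C, C'\<close> are indexed with the offset of \<open>monic_rec\<close>.\<close>

lemma pearson_favard_if_raising:
  fixes B C B' C' d e g :: "nat \<Rightarrow> complex" and l :: complex
  defines "Q \<equiv> monic_rec B C"
  assumes \<psi>: "\<psi> = smult (d 0) (Q 1)"
    and \<phi>: "\<phi> = smult l (Q 2) + smult (e 0) (Q 1) + smult (g 0) (Q 0)"
    and d: "\<And>n. d (Suc n) = d n + l"
    and e: "\<And>n. e n = d n * (B' n - B (Suc n))"
    and g: "g 0 = - d 0 * C 0" "\<And>n. g (Suc n) = d n * C' n - d (Suc n) * C (Suc n)"
    and e': "\<And>n. e (Suc n) = l * B (Suc (Suc n)) + e n - l * B' n"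
    and g': "g (Suc 0) = l * C (Suc 0) + e 0 * B (Suc 0) + g 0 + d 0 - B' 0 * e 0"
      "\<And>n. g (Suc (Suc n)) = l * C (Suc (Suc n)) + e (Suc n) * B (Suc (Suc n)) + g (Suc n) + d (Suc n)
        - B' (Suc n) * e (Suc n) - l * C' n"
    and z: "0 = e 0 * C 0 + g 0 * B 0 - B' 0 * g 0"
      "\<And>n. 0 = e (Suc n) * C (Suc n) + g (Suc n) * B (Suc n) - B' (Suc n) * g (Suc n) - C' n * e n"
      "\<And>n. 0 = g (Suc n) * C n - C' n * g n"
  shows "pearson \<phi> \<psi> (favard Q)"
proof -
  define p where "p = monic_rec B' C'"
  have Qx: "pCons 0 (Q 0) = Q (Suc 0) + smult (B 0) (Q 0)"
    "\<And>n. pCons 0 (Q (Suc n)) = Q (Suc (Suc n)) + smult (B (Suc n)) (Q (Suc n)) + smult (C n) (Q n)"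
    using monic_rec_mult_X[of B C] by (simp_all add: Q_def)
  have pS: "p 0 = 1" "p (Suc 0) = pCons 0 (p 0) - smult (B' 0) (p 0)"
    "\<And>n. p (Suc (Suc n)) = pCons 0 (p (Suc n)) - smult (B' (Suc n)) (p (Suc n)) - smult (C' n) (p n)"
    by (simp_all add: p_def one_pCons)
  \<comment> \<open>The expansion under the exchanged operator is carried along because the rule for
    multiplication by z couples the two.\<close>
  define P where "P n \<longleftrightarrow> pearson_op \<phi> \<psi> (p n) = smult (d n) (Q (Suc n)) \<and>
      pearson_op \<psi> \<phi> (p n) = smult l (Q (Suc (Suc n))) + smult (e n) (Q (Suc n)) + smult (g n) (Q n)" for n
  have P0: "P 0"
    using \<phi> \<psi> by (simp add: P_def pS pearson_op_1 flip: numeral_2_eq_2)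
  have P1: "P 1"
  proof -
    have "pearson_op \<phi> \<psi> (p 1) = smult (d 0 + l) (Q 2) + smult (d 0 * B 1 + e 0 - B' 0 * d 0) (Q 1)
        + smult (d 0 * C 0 + g 0) (Q 0)"
      using P0 by (simp add: P_def pS(2) pearson_op_simps pearson_op_pCons0 Qx smult_add_right
          smult_add_left smult_diff_left algebra_simps eval_nat_numeral pCons_0_linear del: smult_pCons add_pCons)
    moreover have "pearson_op \<psi> \<phi> (p 1) = smult l (Q 3) + smult (l * B 2 + e 0 - l * B' 0) (Q 2)
        + smult (l * C 1 + e 0 * B 1 + g 0 + d 0 - B' 0 * e 0) (Q 1)
        + smult (e 0 * C 0 + g 0 * B 0 - B' 0 * g 0) (Q 0)"
      using P0 by (simp add: P_def pS(2) pearson_op_simps pearson_op_pCons0 Qx smult_add_right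
          smult_add_left smult_diff_left algebra_simps eval_nat_numeral pCons_0_linear del: smult_pCons add_pCons)
    moreover have "d 0 + l = d (Suc 0)" "d 0 * B 1 + e 0 - B' 0 * d 0 = 0" "d 0 * C 0 + g 0 = 0"
      "l * B 2 + e 0 - l * B' 0 = e (Suc 0)"
      "l * C 1 + e 0 * B 1 + g 0 + d 0 - B' 0 * e 0 = g (Suc 0)"
      "e 0 * C 0 + g 0 * B 0 - B' 0 * g 0 = 0"
      using d[of 0] e[of 0] g(1) e'[of 0] g'(1) z(1) by (simp_all add: eval_nat_numeral algebra_simps)
    ultimately show ?thesis
      by (simp only: P_def smult_0_left add_0_right) (simp add: eval_nat_numeral)
  qed
  have PSS: "P (Suc (Suc n))" if "P n" "P (Suc n)" for n
  proof -
    have "pearson_op \<phi> \<psi> (p (Suc (Suc n))) = smult (d (Suc n) + l) (Q (Suc (Suc (Suc n))))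
        + smult (d (Suc n) * B (Suc (Suc n)) + e (Suc n) - B' (Suc n) * d (Suc n)) (Q (Suc (Suc n)))
        + smult (d (Suc n) * C (Suc n) + g (Suc n) - C' n * d n) (Q (Suc n))"
      using that by (simp add: P_def pS pearson_op_simps pearson_op_pCons0 Qx smult_add_right
          smult_add_left smult_diff_left algebra_simps pCons_0_linear del: smult_pCons add_pCons)
    moreover have "pearson_op \<psi> \<phi> (p (Suc (Suc n))) = smult l (Q (Suc (Suc (Suc (Suc n)))))
        + smult (l * B (Suc (Suc (Suc n))) + e (Suc n) - l * B' (Suc n)) (Q (Suc (Suc (Suc n))))
        + smult (l * C (Suc (Suc n)) + e (Suc n) * B (Suc (Suc n)) + g (Suc n) + d (Suc n)
            - B' (Suc n) * e (Suc n) - l * C' n) (Q (Suc (Suc n)))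
        + smult (e (Suc n) * C (Suc n) + g (Suc n) * B (Suc n) - B' (Suc n) * g (Suc n) - C' n * e n) (Q (Suc n))
        + smult (g (Suc n) * C n - C' n * g n) (Q n)"
      using that by (simp add: P_def pS pearson_op_simps pearson_op_pCons0 Qx smult_add_right
          smult_add_left smult_diff_left algebra_simps pCons_0_linear del: smult_pCons add_pCons)
    \<comment> \<open>The relations defining \<open>e\<close> and \<open>g\<close> cancel the two
      lower terms of the first expansion, which leaves a single multiple of
      \<open>Q\<close>.\<close>
    moreover have "d (Suc n) + l = d (Suc (Suc n))"
      "d (Suc n) * B (Suc (Suc n)) + e (Suc n) - B' (Suc n) * d (Suc n) = 0"
      "d (Suc n) * C (Suc n) + g (Suc n) - C' n * d n = 0"
      using d[of "Suc n"] e[of "Suc n"] g(2)[of n] by (simp_all add: algebra_simps)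
    ultimately show ?thesis
      by (simp only: P_def e'[of "Suc n", symmetric] g'(2)[of n, symmetric] z(2,3)[of n, symmetric]
          smult_0_left add_0_right)
  qed
  have "P n" for n
    by (induction n rule: induct_nat_012) (use P0 P1 PSS in simp_all)
  then have *: "favard Q (pearson_op \<phi> \<psi> (p n)) = 0" for n
    by (simp add: P_def dual_simps[OF favard_dual] Q_def favard_monic_rec)
  have "favard Q (pearson_op \<phi> \<psi> q) = 0" for q
    by (rule exact_degree_induct[OF order.refl, where F = p and q = q and V = "\<lambda>q. favard Q (pearson_op \<phi> \<psi> q) = 0"])
      (simp_all add: *[unfolded p_def] p_def pearson_op_simps dual_simps[OF favard_dual])
  then show ?thesis by (simp add: pearson_def)
qed

section \<open>Orthogonality and nondegeneracy\<close>

lemma is_OPS_D: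
  assumes "is_OPS u P"
  shows "degree (P n) = n" "u (P n * P n) \<noteq> 0" "n \<noteq> k \<Longrightarrow> u (P n * P k) = 0"
  using assms by (auto simp: is_OPS_def)

text \<open>The members of index below \<open>n\<close> span the polynomials of degree below
  \<open>n\<close>.\<close>

lemma OPS_orthogonal:
  assumes u: "u \<in> dual" and P: "is_OPS u P" and "degree q < n"
  shows "u (P n * q) = 0"
proof -
  have *: "degree (P k) = k" "P k \<noteq> 0" "k \<noteq> n \<Longrightarrow> u (P n * P k) = 0" for k n
    using is_OPS_D[OF P] dual_simps(4)[OF u] by (metis mult_zero_left)+
  have "degree q \<le> n - 1" using assms by auto
  then show ?thesis
  proof (rule exact_degree_induct[of _ _ P])
    show "coeff (P k) k \<noteq> 0" for k
      using *(2)[of k] *(1)[of k] by (metis leading_coeff_0_iff)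
  qed (use * \<open>degree q < n\<close> in \<open>auto simp: distrib_left dual_simps[OF u]\<close>)
qed

text \<open>Up to terms of lower degree, which are orthogonal to \<open>P (degree q)\<close>, the
  polynomial \<open>q\<close> is a nonzero multiple of \<open>P (degree q)\<close>.\<close>

lemma OPS_nondegenerate:
  assumes u: "u \<in> dual" and P: "is_OPS u P" and q: "q \<noteq> 0"
  shows "u (q * P (degree q)) \<noteq> 0"
proof -
  let ?n = "degree q"
  note dP = is_OPS_D(1)[OF P, of ?n] and nz = is_OPS_D(2)[OF P, of ?n]
  then have lc: "lead_coeff (P ?n) \<noteq> 0"
    using dual_simps(4)[OF u] by (metis leading_coeff_0_iff mult_zero_left)
  define c where "c = lead_coeff q / lead_coeff (P ?n)"
  have c: "c \<noteq> 0" using q lc by (simp add: c_def)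
  have "u (P ?n * (q - smult c (P ?n))) = 0"
  proof (cases "q - smult c (P ?n) = 0")
    case True
    then show ?thesis using dual_simps(4)[OF u] by simp
  next
    case False
    have "degree (q - smult c (P ?n)) \<le> ?n"
      by (rule degree_diff_le) (simp_all add: dP)
    moreover have "coeff (q - smult c (P ?n)) ?n = 0"
      using lc dP by (simp add: c_def)
    ultimately have "degree (q - smult c (P ?n)) < ?n"
      using False by (metis le_neq_implies_less leading_coeff_0_iff)
    then show ?thesis by (rule OPS_orthogonal[OF u P])
  qed
  then have "u (P ?n * q) = c * u (P ?n * P ?n)"
    by (simp add: right_diff_distrib dual_simps[OF u])
  with nz c show ?thesis by (simp add: mult.commute)
qed

lemma OPS_apply_1_nonzero:
  assumes "u \<in> dual" "is_OPS u P"
  shows "u 1 \<noteq> 0"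
proof -
  obtain c where "P 0 = [:c:]" using is_OPS_D(1)[OF assms(2)] by (metis degree_eq_zeroE)
  moreover have "u (1 * P 0) \<noteq> 0"
    using OPS_nondegenerate[OF assms, of 1] by simp
  ultimately have "u [:c:] \<noteq> 0" by simp
  moreover have "u [:c:] = c * u 1" using dual_simps(3)[OF assms(1), of c 1] by simp
  ultimately show ?thesis by auto
qed

section \<open>Admissibility of the pair and uniqueness of the functional\<close>

text \<open>The nonvanishing factors are the top coefficients of the images of the monomials, so 1
  together with these images has one member of each degree up to \<open>n\<close>. The condition on
  \<open>p\<close> expresses degree below \<open>n\<close> and forces \<open>p = 0\<close> for
  \<open>n = 0\<close>.\<close>

lemma const_plus_pearson_op_image:
  assumes "degree \<phi> \<le> 2" "degree \<psi> \<le> 1"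
    and nz: "\<And>k. k < n \<Longrightarrow> of_nat k * coeff \<phi> 2 + coeff \<psi> 1 \<noteq> 0"
    and "degree q \<le> n"
  shows "\<exists>c p. q = [:c:] + pearson_op \<phi> \<psi> p \<and> (\<forall>k\<ge>n. coeff p k = 0)"
proof -
  define V where "V q \<longleftrightarrow> (\<exists>c p. q = [:c:] + pearson_op \<phi> \<psi> p \<and> (\<forall>k\<ge>n. coeff p k = 0))" for q
  define F where "F k = (case k of 0 \<Rightarrow> 1 | Suc m \<Rightarrow> pearson_op \<phi> \<psi> (monom 1 m))" for k
  have VI: "V q" if "q = [:c:] + pearson_op \<phi> \<psi> p" "\<forall>k\<ge>n. coeff p k = 0" for q c p
    using that by (auto simp: V_def)
  from assms(4) have "V q"
  proof (rule exact_degree_induct[of _ _ F])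
    show "degree (F k) \<le> k" if "k \<le> n" for k
      using coeff_pearson_op_monom(1)[OF assms(1,2)] by (cases k) (auto simp: F_def)
    show "coeff (F k) k \<noteq> 0" if "k \<le> n" for k
      using coeff_pearson_op_monom(2)[OF assms(1,2)] nz that by (cases k) (auto simp: F_def)
    show "V (F k)" if "k \<le> n" for k
    proof (cases k)
      case 0
      then show ?thesis by (intro VI[of _ 1 0]) (auto simp: F_def pearson_op_simps one_pCons)
    next
      case (Suc m)
      then show ?thesis using that by (intro VI[of _ 0 "monom 1 m"]) (auto simp: F_def)
    qed
    show "V 0" by (intro VI[of _ 0 0]) (auto simp: pearson_op_simps)
    show "V (p + q)" if V: "V p" "V q" for p q
    proof -
      from V obtain c d p' q' where "p = [:c:] + pearson_op \<phi> \<psi> p'" "\<forall>k\<ge>n. coeff p' k = 0"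
        "q = [:d:] + pearson_op \<phi> \<psi> q'" "\<forall>k\<ge>n. coeff q' k = 0" by (auto simp: V_def)
      then show ?thesis
        by (intro VI[of _ "c + d" "p' + q'"]) (auto simp: pearson_op_simps)
    qed
    show "V (smult a p)" if V: "V p" for a p
    proof -
      from V obtain c p' where "p = [:c:] + pearson_op \<phi> \<psi> p'" "\<forall>k\<ge>n. coeff p' k = 0"
        by (auto simp: V_def)
      then show ?thesis
        by (intro VI[of _ "a * c" "smult a p'"]) (auto simp: pearson_op_simps smult_add_right)
    qed
  qed
  then show ?thesis by (simp add: V_def)
qed

text \<open>If the leading coefficient of \<open>T z\<^sup>N\<close> vanished, a dimension count would give \<open>q \<noteq> 0\<close> with
  \<open>T q = 0\<close>. Then \<open>T (q s) = R Ds\<close> for a fixed polynomial \<open>R\<close>, and since \<open>D\<close> is surjective, \<open>u\<close>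
  would annihilate all multiples of \<open>R\<close>, which regularity forbids.\<close>

lemma regular_imp_admissible_pair:
  assumes u: "u \<in> dual" and P: "is_OPS u P" and pe: "pearson \<phi> \<psi> u"
    and deg: "degree \<phi> \<le> 2" "degree \<psi> \<le> 1" and \<phi>: "\<phi> \<noteq> 0"
  shows "of_nat n * coeff \<phi> 2 + coeff \<psi> 1 \<noteq> 0"
proof
  assume "of_nat n * coeff \<phi> 2 + coeff \<psi> 1 = 0"
  then obtain N where N: "of_nat N * coeff \<phi> 2 + coeff \<psi> 1 = 0"
    and less: "\<And>k. k < N \<Longrightarrow> of_nat k * coeff \<phi> 2 + coeff \<psi> 1 \<noteq> 0"
    using LeastI[of "\<lambda>n. of_nat n * coeff \<phi> 2 + coeff \<psi> 1 = 0"] not_less_Least by blast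
  let ?T = "pearson_op \<phi> \<psi>"
  have "degree (?T (monom 1 N)) \<le> N"
  proof (rule degree_le, intro allI impI)
    fix i assume "N < i"
    then consider "i = Suc N" | "Suc N < i" by linarith
    then show "coeff (?T (monom 1 N)) i = 0"
      using coeff_pearson_op_monom[OF deg, of N] N by cases (auto intro: coeff_eq_0)
  qed
  from const_plus_pearson_op_image[OF deg less this]
  obtain c p where cp: "?T (monom 1 N) = [:c:] + ?T p" "\<forall>k\<ge>N. coeff p k = 0" by blast
  \<comment> \<open>The image of this monic polynomial is a constant. It is killed by
    \<open>u\<close> while \<open>u 1\<close> is nonzero, so the constant is 0.\<close>
  define q where "q = monom 1 N - p"
  have "coeff q N = 1" using cp by (simp add: q_def)
  then have q: "q \<noteq> 0" by auto
  have Tq: "?T q = smult c 1" using cp by (simp add: q_def pearson_op_simps one_pCons)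
  then have "c * u 1 = 0"
    using pe dual_simps(3)[OF u] by (metis pearson_def)
  then have "?T q = 0" using OPS_apply_1_nonzero[OF u P] Tq by simp
  \<comment> \<open>Twice the operator at \<open>q\<close> is (\<phi> + \<psi>) q(z + 1) - (\<phi> -
    \<psi>) q(z - 1). With both products equal, a further factor \<open>s\<close> sees only its own
    difference.\<close>
  then have eq: "(\<phi> + \<psi>) * pcompose q [:1, 1:] = (\<phi> - \<psi>) * pcompose q [:- 1, 1:]" (is "?R = _")
    by (simp add: pearson_op_def cdiff_def cmean_def algebra_simps flip: smult_add_right smult_diff_right)
  have "?T (q * s) = ?R * cdiff s" for s
  proof -
    have "?T (q * s) = smult (1/2) (?R * pcompose s [:1, 1:] - ((\<phi> - \<psi>) * pcompose q [:- 1, 1:]) * pcompose s [:- 1, 1:])"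
      by (simp add: pearson_op_def cdiff_def cmean_def pcompose_mult algebra_simps smult_add_right smult_diff_right)
    also have "\<dots> = smult (1/2) (?R * pcompose s [:1, 1:] - ?R * pcompose s [:- 1, 1:])"
      unfolding eq ..
    also have "\<dots> = ?R * cdiff s"
      by (simp only: cdiff_def mult_smult_right right_diff_distrib)
    finally show ?thesis .
  qed
  then have Rs: "u (?R * cdiff s) = 0" for s
    using pe by (metis pearson_def)
  \<comment> \<open>The differences of the monomials of positive degree have each exact degree once,
    so they span all polynomials.\<close>
  have "u (?R * f) = 0" for f
    by (rule exact_degree_induct[OF order.refl, where F = "\<lambda>k. cdiff (monom 1 (Suc k))"])
      (simp_all only: Rs cdiff_monom dual_simps[OF u] distrib_left mult_smult_right mult_zero_right
        of_nat_eq_0_iff nat.distinct not_False_eq_True add_0_left)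
  then have R: "?R = 0" using OPS_nondegenerate[OF u P, of ?R] by blast
  moreover have "pcompose q [:1, 1:] \<noteq> 0" "pcompose q [:- 1, 1:] \<noteq> 0"
    using q by (auto simp: pcompose_eq_0_iff)
  ultimately have "\<phi> + \<psi> = 0" "\<phi> - \<psi> = 0" using eq by auto
  moreover have "smult 2 \<phi> = (\<phi> + \<psi>) + (\<phi> - \<psi>)" by (simp add: numeral_poly)
  ultimately have "smult 2 \<phi> = 0" by simp
  then show False using \<phi> by simp
qed

text \<open>Every polynomial is a constant plus an image of the operator, and both functionals
  vanish on such images; only the value at 1 is left free.\<close>

lemma pearson_determines_functional:
  assumes u: "u \<in> dual" "pearson \<phi> \<psi> u" and v: "v \<in> dual" "pearson \<phi> \<psi> v"
    and deg: "degree \<phi> \<le> 2" "degree \<psi> \<le> 1" and "v 1 = 1"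
    and nz: "\<And>k. of_nat k * coeff \<phi> 2 + coeff \<psi> 1 \<noteq> 0"
  shows "u q = u 1 * v q"
proof -
  obtain c p where "q = [:c:] + pearson_op \<phi> \<psi> p"
    using const_plus_pearson_op_image[OF deg nz order.refl] by metis
  then have q: "q = smult c 1 + pearson_op \<phi> \<psi> p" by (simp add: one_pCons)
  then have "u q = c * u 1" "v q = c * v 1"
    using u v by (simp_all only: dual_simps pearson_def)
      simp_all
  then show ?thesis using \<open>v 1 = 1\<close> by simp
qed

text \<open>By uniqueness \<open>u\<close> is a multiple of the Favard functional of the recurrence,
  so both monic sequences are orthogonal for \<open>u\<close> to all lower degrees and must
  agree.\<close>

lemma OPS_eq_monic_rec:
  assumes u: "u \<in> dual" and P: "is_OPS u P" and monic: "\<And>n. lead_coeff (P n) = 1"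
    and pe: "pearson \<phi> \<psi> u" "pearson \<phi> \<psi> (favard (monic_rec B C))"
    and deg: "degree \<phi> \<le> 2" "degree \<psi> \<le> 1" and \<phi>: "\<phi> \<noteq> 0"
  shows "P = monic_rec B C" "C n \<noteq> 0"
proof -
  let ?Q = "monic_rec B C"
  have "favard ?Q 1 = 1" using favard_monic_rec[of B C 0] by simp
  then have eq: "u q = u 1 * favard ?Q q" for q
    by (intro pearson_determines_functional[OF u pe(1) favard_dual pe(2) deg]
        regular_imp_admissible_pair[OF u P pe(1) deg \<phi>])
  have dP: "degree (P n) = n" for n using P by (auto simp: is_OPS_def)
  show PQ: "P = ?Q"
  proof
    fix n
    show "P n = ?Q n"
    proof (rule ccontr)
      assume "P n \<noteq> ?Q n"
      \<comment> \<open>The difference has degree below \<open>n\<close> yet is orthogonal to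
        everything of degree below \<open>n\<close>, in particular to
        \<open>P (degree r)\<close>.\<close>
      define r where "r = P n - ?Q n"
      have r: "r \<noteq> 0" using \<open>P n \<noteq> ?Q n\<close> by (simp add: r_def)
      have "degree r \<le> n" unfolding r_def by (rule degree_diff_le) (simp_all add: dP)
      moreover have "coeff r n = 0" using monic[of n] dP[of n] by (simp add: r_def)
      ultimately have rn: "degree r < n" using r by (metis le_neq_implies_less leading_coeff_0_iff)
      have "u (?Q n * q) = 0" if "degree q < n" for q
      proof -
        have "degree q \<le> n - 1" using that by auto
        then have "favard ?Q (q * ?Q n) = 0"
          by (rule exact_degree_induct[of _ _ ?Q])
            (use that favard_orthogonal[of _ n B C] in
              \<open>auto simp: distrib_right dual_simps[OF favard_dual]\<close>)
        then show ?thesis by (simp add: eq[of "_ * _"] mult.commute)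
      qed
      moreover have "degree (P (degree r)) < n" using rn by (simp add: dP)
      ultimately have "u (r * P (degree r)) = 0"
        using OPS_orthogonal[OF u P, of "P (degree r)" n] dual_simps[OF u]
        by (simp add: r_def left_diff_distrib)
      then show False using OPS_nondegenerate[OF u P r] by simp
    qed
  qed
  \<comment> \<open>This norm is \<open>u 1\<close> times the product of \<open>C 0\<close> up to
    \<open>C n\<close>.\<close>
  have "u (P (Suc n) * P (Suc n)) \<noteq> 0" using P by (auto simp: is_OPS_def)
  then show "C n \<noteq> 0"
    using favard_orthogonal[of "Suc n" "Suc n" B C] by (auto simp: PQ eq[of "_ * _"])
qed

section \<open>Functional equations of the two families\<close>

lemma pearson_H:
  assumes "s\<^sup>2 = a + 1"
  shows "pearson [:- b, s:] [:0, 1:] (favard (monic_rec (\<lambda>n. - 2 * of_nat n * s) (H_C a b)))"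
\<comment> \<open>Since \<phi> is at most linear, \<open>l = 0\<close> and \<open>d\<close> is
  constant. The companion is the H family with \<open>b\<close> replaced by \<open>a + b\<close>,
  evaluated at z + s.\<close>
proof (rule pearson_favard_if_raising[where l = 0 and d = "\<lambda>_. 1" and e = "\<lambda>_. s"
      and g = "\<lambda>n. - (a * of_nat n + b)" and B' = "\<lambda>n. - 2 * of_nat n * s - s"
      and C' = "\<lambda>n. (a * (of_nat n + 1) + b) * (of_nat n + 1)"], goal_cases)
  \<comment> \<open>The relation between \<open>s\<close> and \<open>a\<close> enters only in the
    two recurrences for \<open>g\<close>.\<close>
  case (9 n)
  have "s * s = a + 1" using assms by (simp add: power2_eq_square)
  then have "s * (s * 2) = 2 + a * 2" by (simp flip: mult.assoc)
  with \<open>s * s = a + 1\<close> show ?case by (simp add: H_C_def algebra_simps)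
next
  case 8
  have "s * s = a + 1" using assms by (simp add: power2_eq_square)
  then have "s * (s * 2) = 2 + a * 2" by (simp flip: mult.assoc)
  with \<open>s * s = a + 1\<close> show ?case by (simp add: H_C_def algebra_simps)
qed (simp_all add: H_C_def algebra_simps)

text \<open>The companion sequence is the \<open>Q\<close> family with \<open>a\<close> replaced by \<open>a + 1\<close>. The factor \<open>X (n + a)\<close>
  is common to the coefficients \<open>C\<close> of both families.\<close>

lemma pearson_Q:
  assumes "- 2 * a \<notin> \<nat>"
  shows "pearson [:a\<^sup>2 - b\<^sup>2 - c\<^sup>2, 0, 1:] [:- 2 * b * c, 2 * a:] (favard (Q_poly a b c))"
proof -
  have nz: "of_nat k + 2 * a \<noteq> 0" for k
  proof
    assume "of_nat k + 2 * a = 0"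
    then have "- 2 * a = of_nat k" by (simp add: add_eq_0_iff2)
    then show False using assms by simp
  qed
  have nz1: "of_nat k + a \<noteq> 0" for k
    using nz[of "2 * k"] by (auto simp: add_eq_0_iff2)
  have a: "a \<noteq> 0" "2 * a + 1 \<noteq> 0" "a + 1 \<noteq> 0"
    using nz1[of 0] nz[of 1] nz1[of 1] by (auto simp: add.commute)
  define Y where "Y m = (m\<^sup>2 - b\<^sup>2) * (m\<^sup>2 - c\<^sup>2) / m\<^sup>2" for m :: complex
  define X where "X m = - Y m / ((2 * m - 1) * (2 * m + 1))" for m :: complex
  \<comment> \<open>For nonzero \<open>m\<close>, \<open>Y m = m\<^sup>2 - b\<^sup>2 - c\<^sup>2 +
    b\<^sup>2 * c\<^sup>2 / m\<^sup>2\<close>, so its difference contains the factor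
    \<open>2 * m + 1\<close>.\<close>
  have Y: "Y m - Y (m + 1) + (2 * m + 1) * (1 - b\<^sup>2 * c\<^sup>2 / (m\<^sup>2 * (m + 1)\<^sup>2)) = 0"
    if "m \<noteq> 0" "m + 1 \<noteq> 0" for m
    using that unfolding Y_def by (simp add: divide_simps) (simp add: power2_eq_square algebra_simps)
  have C0: "Q_C a b c 0 = - Y a / (2 * a + 1)"
    by (simp add: Q_C_def Y_def)
  have CS: "Q_C a b c (Suc n) = (of_nat n + 2) * (of_nat n + 2 * a) * X (of_nat n + 1 + a)" for n
  proof -
    define m where "m = of_nat n + 1 + a"
    have *: "of_nat (Suc n) + a + b = m + b" "of_nat (Suc n) + a - b = m - b" "of_nat (Suc n) + a + c = m + c"
      "of_nat (Suc n) + a - c = m - c" "of_nat (Suc n) + a = m" "2 * of_nat (Suc n) + 2 * a - 1 = 2 * m - 1"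
      "2 * of_nat (Suc n) + 2 * a + 1 = 2 * m + 1" "of_nat (Suc n) + 1 = (of_nat n + 2 :: complex)"
      "of_nat (Suc n) + 2 * a - 1 = of_nat n + 2 * a"
      by (simp_all add: m_def algebra_simps)
    have Y': "Y m = (m + b) * (m - b) * (m + c) * (m - c) / m\<^sup>2"
      by (simp add: Y_def power2_eq_square algebra_simps)
    show ?thesis
      unfolding Q_C_def * if_False nat.distinct m_def[symmetric] X_def Y' by (simp add: mult_ac)
  qed
  have X_step: "(2 * m + 3) * X (m + 1) = (2 * m - 1) * X m - 1 + b\<^sup>2 * c\<^sup>2 / (m\<^sup>2 * (m + 1)\<^sup>2)"
    if "m \<noteq> 0" "m + 1 \<noteq> 0" "2 * m - 1 \<noteq> 0" "2 * m + 1 \<noteq> 0" "2 * m + 3 \<noteq> 0" for m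
  proof -
    have "(2 * m + 3) * X (m + 1) = - Y (m + 1) / (2 * m + 1)"
      using that by (simp add: X_def divide_simps) (simp add: algebra_simps)
    also have "Y (m + 1) = Y m + (2 * m + 1) * (1 - b\<^sup>2 * c\<^sup>2 / (m\<^sup>2 * (m + 1)\<^sup>2))"
      using Y[of m] that by (simp add: algebra_simps)
    also have "- \<dots> / (2 * m + 1) = - Y m / (2 * m + 1) - 1 + b\<^sup>2 * c\<^sup>2 / (m\<^sup>2 * (m + 1)\<^sup>2)"
      using that by (simp add: diff_divide_distrib add_divide_distrib)
    also have "- Y m / (2 * m + 1) = (2 * m - 1) * X m"
      using that by (simp add: X_def)
    finally show ?thesis .
  qed
  \<comment> \<open>This is \<open>X_step\<close> at \<open>m = a\<close> with the factor
    \<open>2 * a - 1\<close> already cancelled: for a = 1/2 division by zero would turn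
    \<open>X a\<close> into 0.\<close>
  have X_step0: "(2 * a + 3) * X (a + 1) = - Y a / (2 * a + 1) - 1 + b\<^sup>2 * c\<^sup>2 / (a\<^sup>2 * (a + 1)\<^sup>2)"
  proof -
    have "(2 * a + 3) * X (a + 1) = - Y (a + 1) / (2 * a + 1)"
      using nz[of 3] a by (simp add: X_def divide_simps add.commute)
    also have "Y (a + 1) = Y a + (2 * a + 1) * (1 - b\<^sup>2 * c\<^sup>2 / (a\<^sup>2 * (a + 1)\<^sup>2))"
      using Y[of a] a by (simp add: algebra_simps)
    also have "- \<dots> / (2 * a + 1) = - Y a / (2 * a + 1) - 1 + b\<^sup>2 * c\<^sup>2 / (a\<^sup>2 * (a + 1)\<^sup>2)"
      using a by (simp add: diff_divide_distrib add_divide_distrib)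
    finally show ?thesis .
  qed
  have B0: "Q_B a b c 0 = b * c / a" by (simp add: Q_B_def)
  have BS: "Q_B a b c (Suc n) = (a - 1) * b * c / ((of_nat n + 1 + a) * (of_nat n + a))" for n
    by (simp add: Q_B_def algebra_simps)
  have nz1': "of_nat n + a + 1 \<noteq> 0" "of_nat n + a + 2 \<noteq> 0" "1 + of_nat n + a \<noteq> 0" "2 + of_nat n + a \<noteq> 0" for n
    using nz1[of "n + 1"] nz1[of "n + 2"] by (simp_all add: algebra_simps)
  have "pearson [:a\<^sup>2 - b\<^sup>2 - c\<^sup>2, 0, 1:] [:- 2 * b * c, 2 * a:] (favard (monic_rec (Q_B a b c) (Q_C a b c)))"
  \<comment> \<open>\<open>B'\<close> and \<open>C'\<close> are the coefficients for
    \<open>a + 1\<close>. From \<open>d 0 = 2 * a\<close> and \<open>l = 1\<close> one gets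
    \<open>d\<close>; the relations with \<open>B\<close>, \<open>C\<close>, \<open>B'\<close>,
    \<open>C'\<close> then force \<open>e\<close> and \<open>g\<close>.\<close>
  proof (rule pearson_favard_if_raising[where l = 1 and d = "\<lambda>n. of_nat n + 2 * a"
      and e = "\<lambda>n. (of_nat n + 2 * a) * b * c / ((of_nat n + a) * (of_nat n + a + 1))"
      and g = "\<lambda>n. - (of_nat n + 2 * a) * Q_C a b c n / (of_nat n + 1)"
      and B' = "\<lambda>n. a * b * c / ((of_nat n + a) * (of_nat n + a + 1))"
      and C' = "\<lambda>n. (of_nat n + 1) * (of_nat n + 1 + 2 * a) * X (of_nat n + 1 + a)"], goal_cases)
    case 1
    show ?case using a by (simp add: B0)
  next
    case 2
    let ?e = "2 * a * b * c / (a * (a + 1))"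
    have "?e = Q_B a b c 0 + Q_B a b c 1"
      using a BS[of 0] by (simp add: B0 divide_simps) (simp add: algebra_simps)
    moreover have "- (Q_B a b c 0)\<^sup>2 - (2 * a + 1) * Q_C a b c 0 = a\<^sup>2 - b\<^sup>2 - c\<^sup>2"
      using a by (simp add: C0 B0 Y_def divide_simps) (simp add: power2_eq_square algebra_simps)
    moreover have "?e = (of_nat 0 + 2 * a) * b * c / ((of_nat 0 + a) * (of_nat 0 + a + 1))"
      by simp
    ultimately show ?case
      by (simp only:) (simp add: eval_nat_numeral power2_eq_square algebra_simps)
  next
    case (3 n)
    show ?case by simp
  next
    case (4 n)
    show ?case using nz1[of n] nz1'[of n] by (simp add: BS divide_simps) (simp add: algebra_simps)
  next
    case 5
    show ?case by simp
  next
    case (6 n)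
    define x :: complex where "x = of_nat n"
    have "x + 2 \<noteq> 0" using of_nat_neq_0[of "Suc n", where ?'a = complex] by (simp add: x_def add.commute)
    then show ?case
      by (simp add: CS x_def[symmetric] divide_simps) (simp add: algebra_simps)
  next
    case (7 n)
    show ?case using nz1[of n] nz1'[of n] by (simp add: BS divide_simps) (simp add: algebra_simps)
  next
    case 8
    define x y w where "x = X (a + 1)" and "y = Y a / (2 * a + 1)" and "w = b\<^sup>2 * c\<^sup>2 / (a\<^sup>2 * (a + 1)\<^sup>2)"
    define E F G where "E = 2 * a * b * c / (a * (a + 1))" and "F = (a - 1) * b * c / ((1 + a) * a)"
      and "G = a * b * c / (a * (a + 1))"
    have eqs: "(of_nat 0 + 2 * a) * b * c / ((of_nat 0 + a) * (of_nat 0 + a + 1)) = E"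
      "Q_B a b c (Suc 0) = F" "a * b * c / ((of_nat 0 + a) * (of_nat 0 + a + 1)) = G"
      "Q_C a b c (Suc 0) = 4 * a * x" "Q_C a b c 0 = - y"
      by (simp_all add: E_def F_def G_def BS CS C0 x_def y_def add.commute)
    have "E * (F - G) = - 2 * a * w"
      using a nz1'[of 0] by (simp add: E_def F_def G_def w_def divide_simps) (simp add: power2_eq_square algebra_simps)
    moreover have "2 * a * ((2 * a + 3) * x) = 2 * a * (- y - 1 + w)"
      using X_step0 by (simp add: x_def y_def w_def)
    moreover have "- (of_nat (Suc 0) + 2 * a) * (4 * a * x) / (of_nat (Suc 0) + 1) = - (1 + 2 * a) * (2 * a * x)"
      by (simp add: field_simps)
    ultimately show ?case
      unfolding eqs by (simp only:) (simp add: algebra_simps)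
  next
    case (9 n)
    \<comment> \<open>In this variable the identity is \<open>m + a\<close> times
      \<open>X_step\<close>; the term with \<open>w\<close> is supplied by
      \<open>E * (F - G)\<close>. The preceding case is the same with \<open>m = a\<close>.\<close>
    define m where "m = of_nat n + 1 + a"
    define x y w where "x = X (m + 1)" and "y = X m" and "w = b\<^sup>2 * c\<^sup>2 / (m\<^sup>2 * (m + 1)\<^sup>2)"
    have m: "m \<noteq> 0" "m + 1 \<noteq> 0" "2 * m - 1 \<noteq> 0" "2 * m + 1 \<noteq> 0" "2 * m + 3 \<noteq> 0"
      using nz1[of "n + 1"] nz1[of "n + 2"] nz[of "2 * n + 1"] nz[of "2 * n + 3"] nz[of "2 * n + 5"]
      by (simp_all add: m_def algebra_simps)
    define E F G where "E = (m + a) * b * c / (m * (m + 1))" and "F = (a - 1) * b * c / ((m + 1) * m)"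
      and "G = a * b * c / (m * (m + 1))"
    have eqs: "(of_nat (Suc n) + 2 * a) * b * c / ((of_nat (Suc n) + a) * (of_nat (Suc n) + a + 1)) = E"
      "Q_B a b c (Suc (Suc n)) = F" "a * b * c / ((of_nat (Suc n) + a) * (of_nat (Suc n) + a + 1)) = G"
      "Q_C a b c (Suc (Suc n)) = (m + 2 - a) * (m + a) * x" "Q_C a b c (Suc n) = (m + 1 - a) * (m - 1 + a) * y"
      "(of_nat n + 1) * (of_nat n + 1 + 2 * a) * X (of_nat n + 1 + a) = (m - a) * (m + a) * y"
      by (simp_all add: E_def F_def G_def BS CS x_def y_def m_def algebra_simps)
    have of_nat_eqs: "of_nat (Suc (Suc n)) + 1 = m + 2 - a" "of_nat (Suc (Suc n)) + 2 * a = m + a + 1"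
      "of_nat (Suc n) + 1 = m + 1 - a" "of_nat (Suc n) + 2 * a = m + a"
      by (simp_all add: m_def algebra_simps)
    have nz': "m + 2 - a \<noteq> 0" "m + 1 - a \<noteq> 0"
      using of_nat_neq_0[of "n + 2", where ?'a = complex] of_nat_neq_0[of "n + 1", where ?'a = complex]
      by (simp_all add: m_def algebra_simps)
    have lin: "E * (F - G) = - (m + a) * w"
      using m by (simp add: E_def F_def G_def w_def divide_simps) (simp add: power2_eq_square algebra_simps)
    have X: "(m + a) * ((2 * m + 3) * x) = (m + a) * ((2 * m - 1) * y - 1 + w)"
      using X_step[OF m] by (simp add: x_def y_def w_def)
    have cancel: "- (m + a + 1) * ((m + 2 - a) * (m + a) * x) / (m + 2 - a) = - (m + a + 1) * (m + a) * x"
      "- (m + a) * ((m + 1 - a) * (m - 1 + a) * y) / (m + 1 - a) = - (m + a) * (m - 1 + a) * y"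
      using nz' by simp_all
    from lin X have "E * F = G * E - (m + a) * ((2 * m + 3) * x - (2 * m - 1) * y + 1)"
      by (simp add: algebra_simps)
    then show ?case
      unfolding eqs unfolding of_nat_eqs cancel by (simp add: algebra_simps)
  next
    case 10
    show ?case using a by (simp add: B0 divide_simps) (simp add: algebra_simps)
  next
    case (11 n)
    define x y :: complex where "x = of_nat n" and "y = X (x + 1 + a)"
    have "x + 2 \<noteq> 0" using of_nat_neq_0[of "Suc n", where ?'a = complex] by (simp add: x_def add.commute)
    then show ?case using nz1[of n] nz1'[of n]
      by (simp add: BS CS x_def[symmetric] y_def[symmetric] divide_simps) (simp add: algebra_simps)
  next
    case (12 n)
    define x y :: complex where "x = of_nat n" and "y = X (x + 1 + a)"
    have "x + 1 \<noteq> 0" "x + 2 \<noteq> 0"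
      using of_nat_neq_0[of n, where ?'a = complex] of_nat_neq_0[of "Suc n", where ?'a = complex]
      by (simp_all add: x_def add.commute)
    then show ?case
      by (simp add: CS x_def[symmetric] y_def[symmetric] divide_simps) (simp add: algebra_simps)
  qed
  then show ?thesis by (simp add: Q_poly_def)
qed

section \<open>Both families are classical\<close>

lemma classical_OPS_favard:
  assumes "\<And>n. C n \<noteq> 0" "pearson \<phi> \<psi> (favard (monic_rec B C))"
    "degree \<phi> \<le> 2" "degree \<psi> \<le> 1" "\<phi> \<noteq> 0" "\<psi> \<noteq> 0"
  shows "classical_OPS \<gamma> (monic_rec B C)"
  unfolding classical_OPS_def bi_classical_def regular_def
  using assms is_OPS_favard[of C B] favard_dual functional_equation_iff_pearson[OF favard_dual] by blast

lemma of_nat_add_nonzero: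
  fixes x :: complex
  assumes "- x \<notin> \<nat>"
  shows "of_nat n + x \<noteq> 0"
  using assms by (metis add_eq_0_iff2 minus_minus Nats_def of_nat_in_Nats)

lemma Q_admissible_D:
  assumes "Q_admissible a b c"
  shows "of_nat n + 2 * a \<noteq> 0" "of_nat n + a \<noteq> 0" "of_nat n + a + b \<noteq> 0" "of_nat n + a - b \<noteq> 0"
    "of_nat n + a + c \<noteq> 0" "of_nat n + a - c \<noteq> 0"
proof -
  note A = assms[unfolded Q_admissible_def]
  show 1: "of_nat n + 2 * a \<noteq> 0" for n
    using of_nat_add_nonzero[of "2 * a" n] A by simp
  show "of_nat n + a \<noteq> 0"
    using 1[of "2 * n"] by (auto simp: add_eq_0_iff2)
  show "of_nat n + a + b \<noteq> 0" "of_nat n + a - b \<noteq> 0" "of_nat n + a + c \<noteq> 0" "of_nat n + a - c \<noteq> 0"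
    using of_nat_add_nonzero[of "a + b" n] of_nat_add_nonzero[of "a - b" n]
      of_nat_add_nonzero[of "a + c" n] of_nat_add_nonzero[of "a - c" n] A
    by (simp_all add: algebra_simps)
qed

lemma Q_C_nonzero:
  assumes "Q_admissible a b c"
  shows "Q_C a b c n \<noteq> 0"
proof (cases n)
  case 0
  have "a\<^sup>2 - b\<^sup>2 = (a + b) * (a - b)" "a\<^sup>2 - c\<^sup>2 = (a + c) * (a - c)"
    by (simp_all add: power2_eq_square algebra_simps)
  then show ?thesis
    using Q_admissible_D[OF assms, of 0] Q_admissible_D(1)[OF assms, of 1]
    by (simp add: 0 Q_C_def add.commute)
next
  case (Suc m)
  have "of_nat n + 2 * a - 1 \<noteq> 0" "2 * of_nat n + 2 * a - 1 \<noteq> 0" "2 * of_nat n + 2 * a + 1 \<noteq> 0"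
    using Q_admissible_D(1)[OF assms, of m] Q_admissible_D(1)[OF assms, of "2 * m + 1"]
      Q_admissible_D(1)[OF assms, of "2 * n + 1"]
    by (simp_all add: Suc algebra_simps)
  moreover have "of_nat n + 1 \<noteq> (0 :: complex)"
    using of_nat_neq_0[of n, where ?'a = complex] by (simp add: add.commute)
  ultimately show ?thesis
    using Q_admissible_D[OF assms, of n] Suc by (simp add: Q_C_def)
qed

text \<open>A forbidden value of \<open>- a - b\<close>, \<open>- a + b\<close>,
  \<open>- a - c\<close> or \<open>- a + c\<close> is a zero of a numerator factor of some
  \<open>Q_C a b c n\<close>.\<close>

lemma Q_admissible_if_nonzero:
  assumes "- 2 * a \<notin> \<nat>" and nz: "\<And>n. Q_C a b c n \<noteq> 0"
  shows "Q_admissible a b c"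
proof -
  have *: "of_nat n + a + b \<noteq> 0 \<and> of_nat n + a - b \<noteq> 0 \<and> of_nat n + a + c \<noteq> 0 \<and> of_nat n + a - c \<noteq> 0" for n
  proof (cases n)
    case 0
    have "a\<^sup>2 - b\<^sup>2 = (a + b) * (a - b)" "a\<^sup>2 - c\<^sup>2 = (a + c) * (a - c)"
      by (simp_all add: power2_eq_square algebra_simps)
    then show ?thesis using nz[of 0] by (auto simp: Q_C_def 0)
  next
    case (Suc m)
    then show ?thesis using nz[of n] by (auto simp: Q_C_def)
  qed
  have "- x \<notin> \<nat>" if "\<And>n. of_nat n + x \<noteq> 0" for x :: complex
    using that by (metis Nats_cases left_minus)
  from this[of "a + b"] this[of "a - b"] this[of "a + c"] this[of "a - c"] *
  show ?thesis using assms(1) by (simp add: Q_admissible_def add.assoc add_diff_eq)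
qed

lemma classical_OPS_Q:
  assumes "Q_admissible a b c"
  shows "classical_OPS \<gamma> (Q_poly a b c)"
  unfolding Q_poly_def
proof (rule classical_OPS_favard)
  show "pearson [:a\<^sup>2 - b\<^sup>2 - c\<^sup>2, 0, 1:] [:- 2 * b * c, 2 * a:] (favard (monic_rec (Q_B a b c) (Q_C a b c)))"
    using pearson_Q[of a b c] assms by (simp add: Q_admissible_def Q_poly_def)
  show "Q_C a b c n \<noteq> 0" for n by (rule Q_C_nonzero[OF assms])
qed (use Q_admissible_D(2)[OF assms, of 0] in simp_all)

lemma classical_OPS_H:
  assumes sq: "\<And>w. (sq w)\<^sup>2 = w" and adm: "H_admissible a b"
  shows "classical_OPS \<gamma> (H_poly sq a b)"
  unfolding H_poly_def
proof (rule classical_OPS_favard)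
  show "pearson [:- b, sq (a + 1):] [:0, 1:] (favard (monic_rec (H_B sq a) (H_C a b)))"
    unfolding H_B_def[abs_def] by (rule pearson_H[OF sq])
  show "H_C a b n \<noteq> 0" for n
    using adm of_nat_neq_0[of n, where ?'a = complex] by (auto simp: H_C_def H_admissible_def add.commute)
  show "[:- b, sq (a + 1):] \<noteq> 0"
    using adm by (auto simp: H_admissible_def dest: spec[of _ 0])
qed simp_all

section \<open>Affine normalisation and the converse\<close>

text \<open>Reflections \<open>\<alpha> = -1\<close> preserve the step of the operators, other dilations do not.\<close>

lemma pearson_affine:
  assumes u: "u \<in> dual" and \<alpha>: "\<alpha> = 1 \<or> \<alpha> = - 1" and pe: "pearson \<phi> \<psi> u"
    and eq: "pcompose \<phi>' [:\<beta>, \<alpha>:] = smult (\<alpha> * \<kappa>) \<phi>" "pcompose \<psi>' [:\<beta>, \<alpha>:] = smult \<kappa> \<psi>"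
  shows "pearson \<phi>' \<psi>' (\<lambda>q. u (pcompose q [:\<beta>, \<alpha>:]))"
proof -
  \<comment> \<open>For \<alpha> = -1 the two shifts trade places, which negates the difference but
    not the mean; hence the extra \<alpha> in the condition on \<phi>.\<close>
  have "pcompose (cdiff q) [:\<beta>, \<alpha>:] = smult \<alpha> (cdiff (pcompose q [:\<beta>, \<alpha>:]))"
    "pcompose (cmean q) [:\<beta>, \<alpha>:] = cmean (pcompose q [:\<beta>, \<alpha>:])" for q
    using \<alpha> by (auto simp: cdiff_def cmean_def pcompose_smult pcompose_diff pcompose_add
        pcompose_assoc[symmetric] pcompose_pCons algebra_simps smult_diff_right)
  then have "pcompose (pearson_op \<phi>' \<psi>' q) [:\<beta>, \<alpha>:] = smult \<kappa> (pearson_op \<phi> \<psi> (pcompose q [:\<beta>, \<alpha>:]))" for q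
    using \<alpha> eq by (auto simp: pearson_op_def pcompose_add pcompose_mult smult_add_right)
  then show ?thesis
    using pe by (simp add: pearson_def dual_simps[OF u])
qed

text \<open>Substituting in the functional transports \<open>P\<close> to a monic orthogonal
  sequence for the normalised pair, which the uniqueness result identifies.\<close>

lemma OPS_affine_monic_rec:
  assumes u: "u \<in> dual" and P: "is_OPS u P" and monic: "\<And>n. lead_coeff (P n) = 1"
    and pe: "pearson \<phi> \<psi> u" and \<alpha>: "\<alpha> = 1 \<or> \<alpha> = - 1"
    and eq: "pcompose \<phi>' [:\<beta>, \<alpha>:] = smult (\<alpha> * \<kappa>) \<phi>" "pcompose \<psi>' [:\<beta>, \<alpha>:] = smult \<kappa> \<psi>"
    and deg: "degree \<phi>' \<le> 2" "degree \<psi>' \<le> 1" "\<phi>' \<noteq> 0"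
    and fav: "pearson \<phi>' \<psi>' (favard (monic_rec B C))"
  shows "P n = affine \<alpha> \<beta> n (monic_rec B C n)" "C n \<noteq> 0"
proof -
  define v where "v q = u (pcompose q [:\<beta>, \<alpha>:])" for q
  \<comment> \<open>As \<alpha> is its own inverse, this substitution inverts z \<mapsto> \<alpha> z
    + \<beta>; the power of \<alpha> restores monicity.\<close>
  define R where "R n = smult (\<alpha> ^ n) (pcompose (P n) [:- \<alpha> * \<beta>, \<alpha>:])" for n
  have \<alpha>2: "\<alpha> * \<alpha> = 1" "\<alpha> \<noteq> 0" using \<alpha> by auto
  have an: "\<alpha> ^ n * \<alpha> ^ n = 1" for n
    using \<alpha>2 by (metis power_mult_distrib power_one)
  have R_comp: "pcompose (R n) [:\<beta>, \<alpha>:] = smult (\<alpha> ^ n) (P n)" for n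
    using \<alpha>2 by (simp add: R_def pcompose_smult pcompose_assoc[symmetric] pcompose_pCons)
  have v: "v \<in> dual"
    by (rule dualI) (simp_all add: v_def pcompose_add pcompose_smult dual_simps[OF u])
  note dP = is_OPS_D(1)[OF P]
  have dR: "degree (R n) = n" for n
    using \<alpha>2 dP by (simp add: R_def degree_pcompose)
  have mR: "lead_coeff (R n) = 1" for n
  proof -
    have "lead_coeff (pcompose (P n) [:- \<alpha> * \<beta>, \<alpha>:]) = \<alpha> ^ n"
      using \<alpha>2 dP[of n] monic[of n] lead_coeff_comp[of "[:- \<alpha> * \<beta>, \<alpha>:]" "P n"] by simp
    then show ?thesis using an[of n] by (simp only: R_def lead_coeff_smult)
  qed
  have OPS: "is_OPS v R"
  proof -
    obtain h where h: "\<forall>n. h n \<noteq> 0" "\<forall>n k. u (P n * P k) = (if n = k then h n else 0)"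
      using P by (auto simp: is_OPS_def)
    have "v (R n * R k) = (if n = k then h n else 0)" for n k
      using h an[of n] by (auto simp: v_def pcompose_mult R_comp dual_simps[OF u] simp flip: mult.assoc)
    with h dR show ?thesis by (auto simp: is_OPS_def)
  qed
  have pv: "pearson \<phi>' \<psi>' v"
    unfolding v_def by (rule pearson_affine[OF u \<alpha> pe eq])
  note * = OPS_eq_monic_rec[OF v OPS mR pv fav deg]
  show "C n \<noteq> 0" by (rule *)
  have "smult (inverse (\<alpha> ^ n)) (pcompose (R n) [:\<beta>, \<alpha>:]) = P n"
    using \<alpha>2 by (simp add: R_comp)
  then show "P n = affine \<alpha> \<beta> n (monic_rec B C n)"
    by (simp add: affine_def * flip: *(1))
qed

lemma classical_OPS_cases:
  assumes sq: "\<And>w. (sq w)\<^sup>2 = (w :: complex)" and P: "classical_OPS \<gamma> P"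
    and monic: "\<And>n. lead_coeff (P n) = 1"
  shows "\<exists>\<alpha> \<beta>. \<alpha> \<noteq> 0 \<and>
    ((\<exists>a b c. Q_admissible a b c \<and> (\<forall>n. P n = affine \<alpha> \<beta> n (Q_poly a b c n))) \<or>
     (\<exists>a b. H_admissible a b \<and> (\<forall>n. P n = affine \<alpha> \<beta> n (H_poly sq a b n))))"
proof -
  obtain u \<phi> \<psi> where u: "u \<in> dual" and OPS: "is_OPS u P" and \<phi>: "\<phi> \<noteq> 0"
    and deg: "degree \<phi> \<le> 2" "degree \<psi> \<le> 1" and pe: "pearson \<phi> \<psi> u"
    using P functional_equation_iff_pearson by (auto simp: classical_OPS_def bi_classical_def)
  have nz: "of_nat n * coeff \<phi> 2 + coeff \<psi> 1 \<noteq> 0" for n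
    by (rule regular_imp_admissible_pair[OF u OPS pe deg \<phi>])
  obtain p q r where \<phi>_eq: "\<phi> = [:r, q, p:]"
  proof
    show "\<phi> = [:coeff \<phi> 0, coeff \<phi> 1, coeff \<phi> 2:]"
      using deg(1) by (intro poly_eqI) (auto simp: coeff_pCons numeral_2_eq_2 coeff_eq_0 split: nat.split)
  qed
  obtain k t where \<psi>_eq: "\<psi> = [:k, t:]"
  proof
    show "\<psi> = [:coeff \<psi> 0, coeff \<psi> 1:]"
      using deg(2) by (intro poly_eqI) (auto simp: coeff_pCons coeff_eq_0 split: nat.split)
  qed
  have nz: "of_nat n * p + t \<noteq> 0" for n
    using nz[of n] by (simp add: \<phi>_eq \<psi>_eq numeral_2_eq_2)
  note main = OPS_affine_monic_rec[OF u OPS monic pe]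
  show ?thesis
  proof (cases "p = 0")
    case False
    \<comment> \<open>Dividing by \<open>p\<close> and completing the square gives \<phi> / p = (z +
      \<beta>)(z + \<beta>) + e and \<psi> / p = 2a(z + \<beta>) + f.\<close>
    define a where "a = t / (2 * p)"
    define \<beta> where "\<beta> = q / (2 * p)"
    define e where "e = r / p - \<beta>\<^sup>2"
    define f where "f = k / p - 2 * a * \<beta>"
    \<comment> \<open>It remains to solve \<open>b\<^sup>2 + c\<^sup>2 = a\<^sup>2 - e\<close> and
      \<open>- 2 * b * c = f\<close>, which prescribes the squares of \<open>b + c\<close> and
      \<open>b - c\<close>.\<close>
    define b where "b = (sq (a\<^sup>2 - e - f) + sq (a\<^sup>2 - e + f)) / 2"
    define c where "c = (sq (a\<^sup>2 - e - f) - sq (a\<^sup>2 - e + f)) / 2"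
    have "(b + c)\<^sup>2 = a\<^sup>2 - e - f" "(b - c)\<^sup>2 = a\<^sup>2 - e + f"
      using sq by (simp_all add: b_def c_def field_simps)
    moreover have "2 * (a\<^sup>2 - b\<^sup>2 - c\<^sup>2) = 2 * a\<^sup>2 - ((b + c)\<^sup>2 + (b - c)\<^sup>2)"
      "2 * (- 2 * b * c) = (b - c)\<^sup>2 - (b + c)\<^sup>2"
      by (simp_all add: power2_eq_square algebra_simps)
    ultimately have "2 * (a\<^sup>2 - b\<^sup>2 - c\<^sup>2) = 2 * e" "2 * (- 2 * b * c) = 2 * f"
      by simp_all
    then have bc: "a\<^sup>2 - b\<^sup>2 - c\<^sup>2 = e" "- 2 * b * c = f"
      by (metis mult_left_cancel zero_neq_numeral)+
    have adm: "- 2 * a \<notin> \<nat>"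
    proof
      assume "- 2 * a \<in> \<nat>"
      then obtain n where "- 2 * a = of_nat n" by (auto elim: Nats_cases)
      then have "of_nat n * p = - t" using False by (simp add: a_def field_simps)
      then have "of_nat n * p + t = 0" by simp
      with nz show False by blast
    qed
    have eq1: "pcompose [:a\<^sup>2 - b\<^sup>2 - c\<^sup>2, 0, 1:] [:\<beta>, 1:] = smult (1 * (1 / p)) \<phi>"
      using False unfolding bc by (simp add: \<phi>_eq pcompose_pCons e_def \<beta>_def field_simps power2_eq_square)
    have eq2: "pcompose [:- 2 * b * c, 2 * a:] [:\<beta>, 1:] = smult (1 / p) \<psi>"
      using False unfolding bc by (simp add: \<psi>_eq pcompose_pCons f_def a_def field_simps)
    have *: "P n = affine 1 \<beta> n (Q_poly a b c n)" "Q_C a b c n \<noteq> 0" for n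
      using main[OF disjI1[OF refl] eq1 eq2 _ _ _ pearson_Q[OF adm, of b c, unfolded Q_poly_def]]
      by (simp_all add: Q_poly_def)
    then show ?thesis
      using Q_admissible_if_nonzero[OF adm] by (metis zero_neq_one)
  next
    case True
    with nz[of 0] have t: "t \<noteq> 0" by simp
    \<comment> \<open>The given choice \<open>sq\<close> may return the negative of
      \<open>q / t\<close>; a reflection then flips the slope of \<phi> to match it.\<close>
    define \<alpha> :: complex where "\<alpha> = (if sq ((q / t)\<^sup>2) = q / t then 1 else - 1)"
    have \<alpha>: "\<alpha> = 1 \<or> \<alpha> = - 1" by (simp add: \<alpha>_def)
    define s where "s = sq ((q / t)\<^sup>2)"
    define a where "a = (q / t)\<^sup>2 - 1"
    \<comment> \<open>\<beta> moves the zero of \<psi> to the origin, and \<open>b\<close> is read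
      off from the constant term of \<phi>.\<close>
    define \<beta> where "\<beta> = \<alpha> * k / t"
    define b where "b = s * \<beta> - r / t"
    have s: "s = \<alpha> * (q / t)"
      using sq[of "(q / t)\<^sup>2"] by (auto simp: s_def \<alpha>_def power2_eq_iff)
    have eq1: "pcompose [:- b, s:] [:\<beta>, \<alpha>:] = smult (\<alpha> * (\<alpha> / t)) \<phi>"
      using \<alpha> t by (auto simp: \<phi>_eq True pcompose_pCons b_def s)
    have eq2: "pcompose [:0, 1:] [:\<beta>, \<alpha>:] = smult (\<alpha> / t) \<psi>"
      using \<alpha> t by (auto simp: \<psi>_eq pcompose_pCons \<beta>_def)
    have fav: "pearson [:- b, s:] [:0, 1:] (favard (monic_rec (H_B sq a) (H_C a b)))"
      using pearson_H[of s a b] sq by (simp add: H_B_def[abs_def] a_def s_def)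
    have "[:- b, s:] \<noteq> 0"
      using \<phi> \<alpha> t by (auto simp: \<phi>_eq True b_def s)
    then have *: "P n = affine \<alpha> \<beta> n (H_poly sq a b n)" "H_C a b n \<noteq> 0" for n
      using main[OF \<alpha> eq1 eq2 _ _ _ fav] by (simp_all add: H_poly_def)
    then have "H_admissible a b"
      by (auto simp: H_admissible_def H_C_def)
    with *(1) \<alpha> show ?thesis by (metis neg_equal_0_iff_equal zero_neq_one)
  qed
qed

theorem theorem1p2:
  fixes \<gamma> :: complex and sq :: "complex \<Rightarrow> complex"
  assumes sq: "\<And>w. (sq w)^2 = w"
  shows "(\<forall>a b c. Q_admissible a b c \<longrightarrow> classical_OPS \<gamma> (Q_poly a b c)) \<and>
    (\<forall>a b. H_admissible a b \<longrightarrow> classical_OPS \<gamma> (H_poly sq a b)) \<and>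
    (\<forall>P. classical_OPS \<gamma> P \<and> (\<forall>n. lead_coeff (P n) = 1) \<longrightarrow>
      (\<exists>\<alpha> \<beta>. \<alpha> \<noteq> 0 \<and>
        ((\<exists>a b c. Q_admissible a b c \<and> (\<forall>n. P n = affine \<alpha> \<beta> n (Q_poly a b c n))) \<or>
         (\<exists>a b. H_admissible a b \<and> (\<forall>n. P n = affine \<alpha> \<beta> n (H_poly sq a b n))))))"
  using classical_OPS_Q classical_OPS_H[of sq, OF sq] classical_OPS_cases[of sq, OF sq] by blast

end
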